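(* Let $G$ be a Hausdorff topological group with identity $e$. Then $G$ is $\omega$-narrow and a strict $q$-space if and only if for each open neighborhood $O$ of $e$ in $G$ there is a closed sequentially compact invariant subgroup $H$ of $G$ which is of countable character in $G$, such that $H\subseteq O$, the canonical quotient mapping $p:G\rightarrow G/H$ is sequential-perfect, and the quotient group $G/H$ is separable and metrizable.
   Context: All topological groups and spaces are assumed to be Hausdorff. "Invariant subgroup" means normal subgroup. For a subgroup $H$ of $G$, $G/H$ is the space of left cosets with the quotient topology, and $p:G\to G/H$ is the canonical quotient mapping. A topological group $G$ is $\omega$-narrow if for every open neighbourhood $V$ of the identity there is a countable subset $A$ of $G$ such that $AV=G$. A space is sequentially compact if every sequence in it has a convergent subsequence; a subset is sequentially compact if it is so as a subspace. A sequence $\{U_n:n\in\omega\}$ of open neighborhoods of a point $x$ in a space $X$ is a $q$-sequence at $x$ if every sequence $\{x_n\}_{n\in\omega}$ of points of $X$ with $x_n\in U_n$ for each $n\in\omega$ has a point of accumulation in $X$ (a point each of whose neighborhoods contains $x_n$ for infinitely many $n$). A point $x\in X$ is a strict $q$-point if there is a $q$-sequence $\{U_n:n\in\omega\}$ at $x$ such that $\bigcap_{n\in\omega}U_n$ is a sequentially compact set. A space is a strict $q$-space if each of its points is a strict $q$-point. A subset $A$ of a space $X$ is of countable character in $X$ if there is a countable family $\{U_n:n\in\omega\}$ of open neighborhoods of $A$ (open sets containing $A$) such that each open neighborhood $U$ of $A$ contains some $U_n$. A continuous mapping $f:X\to Y$ is sequential-perfect if $f$ is closed and $f^{-1}(y)$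 is a sequentially compact set for each $y\in Y$. *)

theory Defs
  imports "HOL-Analysis.Abstract_Metric_Spaces" "HOL-Algebra.Left_Coset"
begin

section \<open>Topological notions\<close>

definition sequentially_compact_space :: "'a topology \<Rightarrow> bool" where
  "sequentially_compact_space X \<longleftrightarrow>
     (\<forall>s :: nat \<Rightarrow> 'a. range s \<subseteq> topspace X \<longrightarrow>
        (\<exists>l (r :: nat \<Rightarrow> nat). strict_mono r \<and> limitin X (s \<circ> r) l sequentially))"

definition sequentially_compactin :: "'a topology \<Rightarrow> 'a set \<Rightarrow> bool" where
  "sequentially_compactin X S \<longleftrightarrow>
     S \<subseteq> topspace X \<and> sequentially_compact_space (subtopology X S)"

text \<open>Accumulation of a sequence counts indices, not values: a constant sequence accumulates
  at its value. Hence this is not \<open>derived_set_of\<close> of the range.\<close>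

definition accumulation_point_of_seq :: "'a topology \<Rightarrow> (nat \<Rightarrow> 'a) \<Rightarrow> 'a \<Rightarrow> bool" where
  "accumulation_point_of_seq X s l \<longleftrightarrow>
     l \<in> topspace X \<and> (\<forall>V. openin X V \<and> l \<in> V \<longrightarrow> infinite {n. s n \<in> V})"

definition q_sequence_at :: "'a topology \<Rightarrow> 'a \<Rightarrow> (nat \<Rightarrow> 'a set) \<Rightarrow> bool" where
  "q_sequence_at X x U \<longleftrightarrow>
     (\<forall>n. openin X (U n) \<and> x \<in> U n) \<and>
     (\<forall>s. (\<forall>n. s n \<in> U n) \<longrightarrow> (\<exists>l. accumulation_point_of_seq X s l))"

definition strict_q_point :: "'a topology \<Rightarrow> 'a \<Rightarrow> bool" where
  "strict_q_point X x \<longleftrightarrow>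
     x \<in> topspace X \<and> (\<exists>U. q_sequence_at X x U \<and> sequentially_compactin X (\<Inter>n. U n))"

definition strict_q_space :: "'a topology \<Rightarrow> bool" where
  "strict_q_space X \<longleftrightarrow> (\<forall>x \<in> topspace X. strict_q_point X x)"

definition countable_character_in :: "'a topology \<Rightarrow> 'a set \<Rightarrow> bool" where
  "countable_character_in X A \<longleftrightarrow>
     A \<subseteq> topspace X \<and>
     (\<exists>U :: nat \<Rightarrow> 'a set. (\<forall>n. openin X (U n) \<and> A \<subseteq> U n) \<and>
        (\<forall>W. openin X W \<and> A \<subseteq> W \<longrightarrow> (\<exists>n. U n \<subseteq> W)))"

definition sequential_perfect_map :: "'a topology \<Rightarrow> 'b topology \<Rightarrow> ('a \<Rightarrow> 'b) \<Rightarrow> bool" where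
  "sequential_perfect_map X Y f \<longleftrightarrow>
     continuous_map X Y f \<and> closed_map X Y f \<and>
     (\<forall>y \<in> topspace Y. sequentially_compactin X {x \<in> topspace X. f x = y})"

text \<open>The finest topology on the image of \<open>f\<close> that makes \<open>f\<close> continuous.\<close>

definition quotient_topology :: "'a topology \<Rightarrow> ('a \<Rightarrow> 'b) \<Rightarrow> 'b topology" where
  "quotient_topology X f =
     topology (\<lambda>U. U \<subseteq> f ` topspace X \<and> openin X {x \<in> topspace X. f x \<in> U})"

lemma openin_quotient_topology:
  "openin (quotient_topology X f) U \<longleftrightarrow>
     U \<subseteq> f ` topspace X \<and> openin X {x \<in> topspace X. f x \<in> U}"
proof -
  let ?L = "\<lambda>U. U \<subseteq> f ` topspace X \<and> openin X {x \<in> topspace X. f x \<in> U}"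
  have int: "?L (S \<inter> T)" if "?L S" "?L T" for S T
  proof -
    have "{x \<in> topspace X. f x \<in> S \<inter> T} =
          {x \<in> topspace X. f x \<in> S} \<inter> {x \<in> topspace X. f x \<in> T}"
      by auto
    then show ?thesis using that by auto
  qed
  have un: "?L (\<Union>K)" if "\<forall>S\<in>K. ?L S" for K
  proof -
    have "{x \<in> topspace X. f x \<in> \<Union>K} = (\<Union>S\<in>K. {x \<in> topspace X. f x \<in> S})"
      by auto
    moreover have "openin X (\<Union>S\<in>K. {x \<in> topspace X. f x \<in> S})"
      using that by blast
    ultimately show ?thesis using that by auto
  qed
  have "istopology ?L"
    unfolding istopology_def using int un by blast
  then show ?thesis
    by (simp add: quotient_topology_def)
qed

lemma topspace_quotient_topology [simp]:
  "topspace (quotient_topology X f) = f ` topspace X"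
proof
  show "topspace (quotient_topology X f) \<subseteq> f ` topspace X"
    using openin_topspace [of "quotient_topology X f"]
    by (simp only: openin_quotient_topology)
  have "{x \<in> topspace X. f x \<in> f ` topspace X} = topspace X"
    by auto
  then have "openin (quotient_topology X f) (f ` topspace X)"
    by (simp add: openin_quotient_topology)
  then show "f ` topspace X \<subseteq> topspace (quotient_topology X f)"
    by (rule openin_subset)
qed

lemma quotient_map_quotient_topology: "quotient_map X (quotient_topology X f) f"
  by (auto simp: quotient_map_def openin_quotient_topology)


section \<open>Topological groups\<close>

locale topological_group = group G for G (structure) +
  fixes T :: "'a topology"
  assumes topspace_eq_carrier: "topspace T = carrier G"
    and continuous_mult: "continuous_map (prod_topology T T) T (\<lambda>(x, y). x \<otimes> y)"
    and continuous_inv: "continuous_map T T (\<lambda>x. inv x)"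

definition omega_narrow :: "('a, 'b) monoid_scheme \<Rightarrow> 'a topology \<Rightarrow> bool" where
  "omega_narrow G T \<longleftrightarrow>
     (\<forall>V. openin T V \<and> \<one>\<^bsub>G\<^esub> \<in> V \<longrightarrow>
        (\<exists>A. countable A \<and> A \<subseteq> carrier G \<and> A <#>\<^bsub>G\<^esub> V = carrier G))"

definition coset_map :: "('a, 'b) monoid_scheme \<Rightarrow> 'a set \<Rightarrow> 'a \<Rightarrow> 'a set" where
  "coset_map G H = (\<lambda>x. x <#\<^bsub>G\<^esub> H)"

definition coset_topology ::
  "('a, 'b) monoid_scheme \<Rightarrow> 'a topology \<Rightarrow> 'a set \<Rightarrow> 'a set topology" where
  "coset_topology G T H = quotient_topology T (coset_map G H)"

lemma (in topological_group) topspace_coset_topology: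
  "topspace (coset_topology G T H) = carrier (G LMod H)"
  by (auto simp: coset_topology_def coset_map_def topspace_eq_carrier LFactGroup_def LCOSETS_def)

lemma (in topological_group) topspace_coset_topology_normal:
  assumes "H \<lhd> G"
  shows "topspace (coset_topology G T H) = carrier (G Mod H)"
  using normal.coset_eq[OF assms]
  by (auto simp: coset_topology_def coset_map_def topspace_eq_carrier FactGroup_def RCOSETS_def)

end

theory Submission
  imports Defs
begin

text \<open>An omega-narrow group is omega-balanced, so a q-sequence at the identity can be refined to
  symmetric neighbourhoods \<open>W n\<close> with \<open>W (Suc n)\<^sup>3 \<subseteq> W n\<close>, arranged diagonally so that every
  conjugate of every \<open>W n\<close> contains some \<open>W m\<close>. Then \<open>H = (\<Inter>n. W n)\<close> is a closed normal
  subgroup, sequentially compact since it lies in the intersection of the q-sequence, and the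
  q-property turns the \<open>W n\<close> into a neighbourhood base of \<open>H\<close>. This makes the quotient map closed,
  and the Birkhoff--Kakutani norm \<open>gnorm\<close> of the \<open>W n\<close> metrizes the quotient.
  Conversely, the preimages under a sequential-perfect map onto a metrizable space of shrinking
  balls around a point form a q-sequence with sequentially compact intersection.\<close>

section \<open>Sequential compactness\<close>

text \<open>For a sequence inside \<open>S\<close>, convergence in the subspace is ambient
  convergence to a point of \<open>S\<close>. Subsequences can thus be handled in \<open>X\<close>
  alone, with membership of the limit as the only extra condition.\<close>

lemma sequentially_compactin_iff:
  "sequentially_compactin X S \<longleftrightarrow>
     S \<subseteq> topspace X \<and>
     (\<forall>s :: nat \<Rightarrow> 'a. range s \<subseteq> S \<longrightarrow>
        (\<exists>l\<in>S. \<exists>r :: nat \<Rightarrow> nat. strict_mono r \<and> limitin X (s \<circ> r) l sequentially))"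
proof -
  have lim: "limitin (subtopology X S) (s \<circ> r) l sequentially \<longleftrightarrow>
      l \<in> S \<and> limitin X (s \<circ> r) l sequentially" if "range s \<subseteq> S" for s :: "nat \<Rightarrow> 'a" and l r
    using that by (auto simp: limitin_subtopology intro!: always_eventually)
  show ?thesis
    unfolding sequentially_compactin_def sequentially_compact_space_def
  proof (intro conj_cong refl all_cong1)
    fix s :: "nat \<Rightarrow> 'a"
    assume "S \<subseteq> topspace X"
    then have "topspace (subtopology X S) = S" by auto
    then show "(range s \<subseteq> topspace (subtopology X S) \<longrightarrow>
        (\<exists>l r. strict_mono r \<and> limitin (subtopology X S) (s \<circ> r) l sequentially)) =
      (range s \<subseteq> S \<longrightarrow> (\<exists>l\<in>S. \<exists>r. strict_mono r \<and> limitin X (s \<circ> r) l sequentially))"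
      using lim by auto
  qed
qed

lemma sequentially_compactin_closed_subset:
  assumes "sequentially_compactin X K" "closedin X S" "S \<subseteq> K"
  shows "sequentially_compactin X S"
  unfolding sequentially_compactin_iff
proof (intro conjI allI impI)
  show "S \<subseteq> topspace X" using assms(2) by (rule closedin_subset)
  fix s :: "nat \<Rightarrow> 'a"
  assume s: "range s \<subseteq> S"
  then obtain l and r :: "nat \<Rightarrow> nat"
    where r: "strict_mono r" and l: "limitin X (s \<circ> r) l sequentially"
    using assms(1,3) unfolding sequentially_compactin_iff by (meson order_trans)
  have "l \<in> S"
    using l assms(2) by (rule limitin_closedin) (use s in \<open>auto intro!: always_eventually\<close>)
  then show "\<exists>l\<in>S. \<exists>r. strict_mono r \<and> limitin X (s \<circ> r) l sequentially"
    using r l by blast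
qed

text \<open>Lift the sequence pointwise to \<open>S\<close> and push the convergent subsequence
  forward. Applied to left translations, this transfers sequential compactness from a subgroup to
  its cosets.\<close>

lemma sequentially_compactin_continuous_image:
  assumes "continuous_map X Y f" "sequentially_compactin X S"
  shows "sequentially_compactin Y (f ` S)"
  unfolding sequentially_compactin_iff
proof (intro conjI allI impI)
  show "f ` S \<subseteq> topspace Y"
    using assms continuous_map_image_subset_topspace[OF assms(1)]
    unfolding sequentially_compactin_iff by blast
  fix s :: "nat \<Rightarrow> 'b"
  assume s: "range s \<subseteq> f ` S"
  then have "\<forall>n. \<exists>x\<in>S. s n = f x" by auto
  then obtain t where t: "\<And>n. t n \<in> S" "\<And>n. s n = f (t n)" by metis
  then obtain l and r :: "nat \<Rightarrow> nat"
    where l: "l \<in> S" "strict_mono r" "limitin X (t \<circ> r) l sequentially"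
    using assms(2) unfolding sequentially_compactin_iff by (metis image_subsetI)
  have "s \<circ> r = f \<circ> (t \<circ> r)" using t by auto
  then have "limitin Y (s \<circ> r) (f l) sequentially"
    using continuous_map_limit[OF assms(1) l(3)] by simp
  then show "\<exists>l\<in>f ` S. \<exists>r. strict_mono r \<and> limitin Y (s \<circ> r) l sequentially"
    using l by blast
qed

text \<open>The closures of the tails of a sequence map onto closed sets, so when the image sequence
  converges to \<open>y\<close> they all meet the fibre over \<open>y\<close>; points chosen there subconverge to an
  accumulation point.\<close>

lemma accumulation_point_of_closed_map:
  assumes f: "closed_map X Y f" and K: "sequentially_compactin X {x \<in> topspace X. f x = y}"
    and s: "range s \<subseteq> topspace X" and lim: "limitin Y (f \<circ> s) y sequentially"
  shows "\<exists>l. accumulation_point_of_seq X s l"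
proof -
  define F where "F n = X closure_of (s ` {n..})" for n
  have "\<exists>x. x \<in> F n \<and> f x = y" for n
  proof -
    have "closedin Y (f ` F n)"
      using f unfolding F_def by (simp add: closed_map_def)
    moreover have "s k \<in> F n" if "n \<le> k" for k
      unfolding F_def by (rule subsetD[OF closure_of_subset]) (use s that in auto)
    then have "eventually (\<lambda>k. (f \<circ> s) k \<in> f ` F n) sequentially"
      by (auto simp: eventually_sequentially)
    ultimately have "y \<in> f ` F n"
      using limitin_closedin[OF lim] by simp
    then show ?thesis by auto
  qed
  then obtain t where t: "\<And>n. t n \<in> F n" "\<And>n. f (t n) = y" by metis
  have "F n \<subseteq> topspace X" for n
    unfolding F_def by (rule closure_of_subset_topspace)
  then have "range t \<subseteq> {x \<in> topspace X. f x = y}" using t by blast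
  then obtain l and r :: "nat \<Rightarrow> nat" where r: "strict_mono r"
    and l: "limitin X (t \<circ> r) l sequentially"
    using K unfolding sequentially_compactin_iff by metis
  have "infinite {n. s n \<in> V}" if V: "openin X V" "l \<in> V" for V
    unfolding infinite_nat_iff_unbounded_le
  proof
    fix m
    obtain N where N: "\<And>n. N \<le> n \<Longrightarrow> t (r n) \<in> V"
      using l V unfolding limitin_sequentially by auto
    define n where "n = r (max N m)"
    have "m \<le> n" using seq_suble[OF r, of "max N m"] unfolding n_def by linarith
    have "t n \<in> V" unfolding n_def by (intro N) simp
    then obtain k where "k \<ge> n" "s k \<in> V"
      using t(1)[of n] V(1) unfolding F_def in_closure_of by auto
    with \<open>m \<le> n\<close> show "\<exists>k\<ge>m. k \<in> {n. s n \<in> V}"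
      by (intro exI[of _ k]) simp
  qed
  then show ?thesis
    using l unfolding accumulation_point_of_seq_def limitin_def by blast
qed

text \<open>If \<open>s n\<close> lies over the ball of radius \<open>1/(n+1)\<close> about
  \<open>f x\<close>, then the images converge to \<open>f x\<close>, and closedness of
  \<open>f\<close> with a sequentially compact fibre yields an accumulation point. The intersection
  of these preimages is exactly the fibre through \<open>x\<close>.\<close>

lemma strict_q_space_sequential_perfect_preimage:
  assumes Y: "metrizable_space Y" and f: "sequential_perfect_map X Y f"
  shows "strict_q_space X"
  unfolding strict_q_space_def
proof
  fix x assume x: "x \<in> topspace X"
  obtain M d where "Metric_space M d" and Yd: "Y = Metric_space.mtopology M d"
    using Y unfolding metrizable_space_def by blast
  then interpret Metric_space M d by blast
  have cont: "continuous_map X Y f" and cl: "closed_map X Y f"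
    and fib: "\<And>y. y \<in> topspace Y \<Longrightarrow> sequentially_compactin X {x \<in> topspace X. f x = y}"
    using f unfolding sequential_perfect_map_def by auto
  have fM: "f z \<in> M" if "z \<in> topspace X" for z
    using cont that Yd continuous_map_image_subset_topspace by fastforce
  define U where "U n = {z \<in> topspace X. f z \<in> mball (f x) (inverse (Suc n))}" for n
  have "openin X (U n)" for n
    unfolding U_def using cont Yd openin_continuous_map_preimage openin_mball by blast
  moreover have "x \<in> U n" for n
    using x fM unfolding U_def by simp
  moreover have "\<exists>l. accumulation_point_of_seq X s l" if s: "\<And>n. s n \<in> U n" for s
  proof (rule accumulation_point_of_closed_map[OF cl fib])
    show "range s \<subseteq> topspace X" using s unfolding U_def by auto
    show "f x \<in> topspace Y" using x fM Yd by simp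
    have "\<forall>\<^sub>F n in sequentially. f (s n) \<in> M \<and> d (f (s n)) (f x) < e" if "e > 0" for e
    proof -
      have "\<forall>\<^sub>F n in sequentially. inverse (real (Suc n)) < e"
        using order_tendstoD(2)[OF LIMSEQ_inverse_real_of_nat \<open>e > 0\<close>] .
      then show ?thesis
      proof (rule eventually_mono)
        fix n assume n: "inverse (real (Suc n)) < e"
        have "f (s n) \<in> M" "d (f x) (f (s n)) < inverse (real (Suc n))"
          using s[of n] unfolding U_def by auto
        then show "f (s n) \<in> M \<and> d (f (s n)) (f x) < e"
          using n commute[of "f x" "f (s n)"] by linarith
      qed
    qed
    then show "limitin Y (f \<circ> s) (f x) sequentially"
      using x fM unfolding Yd limitin_metric by simp
  qed
  moreover have "(\<Inter>n. U n) = {z \<in> topspace X. f z = f x}"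
  proof (intro equalityI subsetI)
    fix z assume z: "z \<in> (\<Inter>n. U n)"
    then have zX: "z \<in> topspace X" unfolding U_def by auto
    have "d (f x) (f z) < inverse (Suc n)" for n
      using z unfolding U_def by auto
    then have "\<not> d (f x) (f z) > 0"
      using reals_Archimedean by (meson less_asym)
    then have "d (f x) (f z) = 0" using nonneg[of "f x" "f z"] by linarith
    then show "z \<in> {z \<in> topspace X. f z = f x}" using zX x fM by simp
  qed (use x fM in \<open>auto simp: U_def\<close>)
  ultimately have "q_sequence_at X x U" "sequentially_compactin X (\<Inter>n. U n)"
    using fib[of "f x"] x fM Yd unfolding q_sequence_at_def by auto
  then show "strict_q_point X x"
    using x unfolding strict_q_point_def by blast
qed


section \<open>Neighbourhoods in topological groups\<close>

context topological_group
begin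

lemma openin_carrier: "openin T U \<Longrightarrow> x \<in> U \<Longrightarrow> x \<in> carrier G"
  using openin_subset topspace_eq_carrier by blast

lemma continuous_map_mult:
  assumes "continuous_map X T f" "continuous_map X T g"
  shows "continuous_map X T (\<lambda>x. f x \<otimes> g x)"
proof -
  have "continuous_map X (prod_topology T T) (\<lambda>x. (f x, g x))"
    using assms by (simp add: continuous_map_pairedI)
  from continuous_map_compose[OF this continuous_mult] show ?thesis
    by (simp add: o_def)
qed

lemma continuous_map_inv:
  "continuous_map X T f \<Longrightarrow> continuous_map X T (\<lambda>x. inv (f x))"
  using continuous_map_compose[OF _ continuous_inv] by (simp add: o_def)

lemma continuous_map_lmult: "a \<in> carrier G \<Longrightarrow> continuous_map T T (\<lambda>x. a \<otimes> x)"
  by (intro continuous_map_mult) (auto simp: topspace_eq_carrier)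

lemma continuous_map_conj:
  "a \<in> carrier G \<Longrightarrow> continuous_map T T (\<lambda>x. a \<otimes> x \<otimes> inv a)"
  by (intro continuous_map_mult) (auto simp: topspace_eq_carrier)

lemma openin_preimage:
  "continuous_map T T f \<Longrightarrow> openin T U \<Longrightarrow> openin T {x \<in> carrier G. f x \<in> U}"
  using openin_continuous_map_preimage topspace_eq_carrier by metis

lemma openin_ltranslate:
  "a \<in> carrier G \<Longrightarrow> openin T U \<Longrightarrow> openin T {x \<in> carrier G. a \<otimes> x \<in> U}"
  by (intro openin_preimage continuous_map_lmult)

lemma openin_carrier_self [simp]: "openin T (carrier G)"
  using openin_topspace topspace_eq_carrier by metis

lemma nbhd_mult:
  assumes U: "openin T U" "\<one> \<in> U"
  obtains V where "openin T V" "\<one> \<in> V" "\<And>x y. x \<in> V \<Longrightarrow> y \<in> V \<Longrightarrow> x \<otimes> y \<in> U"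
proof -
  have "openin (prod_topology T T) {p \<in> topspace (prod_topology T T). (\<lambda>(x, y). x \<otimes> y) p \<in> U}"
    using continuous_mult U(1) by (rule openin_continuous_map_preimage)
  moreover have "(\<one>, \<one>) \<in> {p \<in> topspace (prod_topology T T). (\<lambda>(x, y). x \<otimes> y) p \<in> U}"
    using U by (simp add: topspace_eq_carrier)
  ultimately obtain A B where "openin T A" "openin T B" "\<one> \<in> A" "\<one> \<in> B"
    and AB: "A \<times> B \<subseteq> {p \<in> topspace (prod_topology T T). (\<lambda>(x, y). x \<otimes> y) p \<in> U}"
    unfolding openin_prod_topology_alt by meson
  then show thesis
    by (intro that[of "A \<inter> B"]) auto
qed

lemma symmetric_nbhd_cube:
  assumes U: "openin T U" "\<one> \<in> U"
  obtains V where "openin T V" "\<one> \<in> V" "\<And>x. x \<in> V \<Longrightarrow> inv x \<in> V"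
    "\<And>x y z. x \<in> V \<Longrightarrow> y \<in> V \<Longrightarrow> z \<in> V \<Longrightarrow> x \<otimes> y \<otimes> z \<in> U"
proof -
  obtain A where A: "openin T A" "\<one> \<in> A" "\<And>x y. x \<in> A \<Longrightarrow> y \<in> A \<Longrightarrow> x \<otimes> y \<in> U"
    using nbhd_mult[OF U] by blast
  obtain B where B: "openin T B" "\<one> \<in> B" "\<And>x y. x \<in> B \<Longrightarrow> y \<in> B \<Longrightarrow> x \<otimes> y \<in> A"
    using nbhd_mult[OF A(1,2)] by blast
  \<comment> \<open>The first two factors are multiplied inside \<open>B\<close> and land in
    \<open>A\<close>; the third factor must itself lie in \<open>A\<close>. Symmetry is obtained
    afterwards by intersecting with the set of inverses.\<close>
  define C where "C = A \<inter> B"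
  have C: "openin T C" "\<one> \<in> C" using A B by (auto simp: C_def)
  show thesis
  proof
    show "openin T (C \<inter> {x \<in> carrier G. inv x \<in> C})"
      using C by (intro openin_Int openin_preimage continuous_inv)
    show "inv x \<in> C \<inter> {x \<in> carrier G. inv x \<in> C}" if "x \<in> C \<inter> {x \<in> carrier G. inv x \<in> C}" for x
      using that by auto
    show "x \<otimes> y \<otimes> z \<in> U" if "x \<in> C \<inter> {x \<in> carrier G. inv x \<in> C}"
      "y \<in> C \<inter> {x \<in> carrier G. inv x \<in> C}" "z \<in> C \<inter> {x \<in> carrier G. inv x \<in> C}" for x y z
      using that by (intro A(3) B(3)) (auto simp: C_def)
  qed (use C in auto)
qed

text \<open>Omega-narrow groups are omega-balanced: if \<open>AV = G\<close> then \<open>inv x = av\<close> for some \<open>a \<in> A\<close>,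
  so that \<open>x\<close> conjugates \<open>aV(inv a)\<close> into \<open>(inv v)Vv\<close>.\<close>

lemma omega_narrow_balanced:
  assumes nar: "omega_narrow G T" and U: "openin T U" "\<one> \<in> U"
  obtains C :: "nat \<Rightarrow> 'a set" where "\<And>i. openin T (C i)" "\<And>i. \<one> \<in> C i"
    "\<And>x. x \<in> carrier G \<Longrightarrow> \<exists>i. \<forall>h\<in>C i. x \<otimes> h \<otimes> inv x \<in> U"
proof -
  obtain V where V: "openin T V" "\<one> \<in> V" "\<And>x. x \<in> V \<Longrightarrow> inv x \<in> V"
    "\<And>x y z. x \<in> V \<Longrightarrow> y \<in> V \<Longrightarrow> z \<in> V \<Longrightarrow> x \<otimes> y \<otimes> z \<in> U"
    by (rule symmetric_nbhd_cube[OF U]) blast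
  obtain A where A: "countable A" "A \<subseteq> carrier G" "A <#> V = carrier G"
    using nar[unfolded omega_narrow_def, rule_format, OF conjI, OF V(1,2)] by (elim exE conjE)
  \<comment> \<open>Nonemptiness allows \<open>A\<close> to be enumerated by all naturals, with
    repetitions if it is finite.\<close>
  have "A \<noteq> {}" using A(3) one_closed by (auto simp: set_mult_def)
  define a where "a = from_nat_into A"
  have aA: "range a = A" unfolding a_def using \<open>A \<noteq> {}\<close> A(1) by (rule range_from_nat_into)
  then have aG: "a i \<in> carrier G" for i using A(2) by auto
  show thesis
  proof
    fix i
    \<comment> \<open>The witness for \<open>C i\<close> is the conjugate of \<open>V\<close> by
      \<open>a i\<close>, written as a preimage so that it is open by continuity of
      conjugation.\<close>
    show "openin T {h \<in> carrier G. inv (a i) \<otimes> h \<otimes> inv (inv (a i)) \<in> V}"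
      by (intro openin_preimage continuous_map_conj V aG inv_closed)
    show "\<one> \<in> {h \<in> carrier G. inv (a i) \<otimes> h \<otimes> inv (inv (a i)) \<in> V}"
      using V(2) aG by simp
  next
    fix x assume x: "x \<in> carrier G"
    then have "inv x \<in> A <#> V" using A(3) by simp
    then obtain i v where v: "v \<in> V" "inv x = a i \<otimes> v"
      unfolding set_mult_def using aA by blast
    have vG: "v \<in> carrier G" using v V openin_carrier by blast
    have xi: "x = inv v \<otimes> inv (a i)"
      using inv_inv[OF x] inv_mult_group[OF aG[of i] vG] unfolding v(2) by simp
    have "x \<otimes> h \<otimes> inv x \<in> U"
      if "h \<in> carrier G" "inv (a i) \<otimes> h \<otimes> inv (inv (a i)) \<in> V" for h
    proof -
      have "x \<otimes> h \<otimes> inv x = inv v \<otimes> (inv (a i) \<otimes> h \<otimes> inv (inv (a i))) \<otimes> v"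
        unfolding v(2) using that(1) vG aG[of i] by (simp add: xi m_assoc)
      also have "\<dots> \<in> U"
        by (intro V(4) V(3) v(1) that(2))
      finally show ?thesis .
    qed
    then show "\<exists>i. \<forall>h\<in>{h \<in> carrier G. inv (a i) \<otimes> h \<otimes> inv (inv (a i)) \<in> V}. x \<otimes> h \<otimes> inv x \<in> U"
      by blast
  qed
qed

section \<open>Cosets and the quotient topology\<close>

lemma coset_map_eq_iff:
  assumes "subgroup H G" "x \<in> carrier G" "y \<in> carrier G"
  shows "coset_map G H x = coset_map G H y \<longleftrightarrow> inv x \<otimes> y \<in> H"
proof -
  interpret subgroup H G by fact
  show ?thesis
  proof
    assume "coset_map G H x = coset_map G H y"
    then have "y \<in> x <# H" using lcos_self[OF assms(3,1)] unfolding coset_map_def by simp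
    then show "inv x \<otimes> y \<in> H" using lcos_module_imp[OF is_group assms(2)] by blast
  next
    assume "inv x \<otimes> y \<in> H"
    then have "y \<in> x <# H" using lcos_module_rev[OF is_group assms(2,3)] by blast
    then show "coset_map G H x = coset_map G H y"
      using l_repr_independence[OF _ assms(2,1)] unfolding coset_map_def by blast
  qed
qed

lemma topspace_coset: "topspace (coset_topology G T H) = coset_map G H ` carrier G"
  by (simp add: coset_topology_def topspace_eq_carrier)

lemma openin_coset_topology:
  "openin (coset_topology G T H) U \<longleftrightarrow>
     U \<subseteq> coset_map G H ` carrier G \<and> openin T {x \<in> carrier G. coset_map G H x \<in> U}"
  by (simp add: coset_topology_def openin_quotient_topology topspace_eq_carrier)

end


section \<open>The metric induced by a sequence of neighbourhoods\<close>

lemma (in group) mult_inv_mult_cancel: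
  "x \<in> carrier G \<Longrightarrow> y \<in> carrier G \<Longrightarrow> x \<otimes> (inv x \<otimes> y) = y"
  by (simp add: m_assoc[symmetric])

text \<open>The hypotheses of the Birkhoff-Kakutani construction. Cubes are used because a product
  will be cut into three pieces; \<open>W 0\<close> is the whole group so that every element has a
  factorization of finite weight.\<close>

locale nested_nbhds = topological_group +
  fixes W :: "nat \<Rightarrow> 'a set"
  assumes W_0: "W 0 = carrier G"
    and openin_W: "\<And>n. openin T (W n)"
    and one_W: "\<And>n. \<one> \<in> W n"
    and inv_W: "\<And>n x. x \<in> W n \<Longrightarrow> inv x \<in> W n"
    and cube_W: "\<And>n x y z. x \<in> W (Suc n) \<Longrightarrow> y \<in> W (Suc n) \<Longrightarrow> z \<in> W (Suc n) \<Longrightarrow>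
      x \<otimes> y \<otimes> z \<in> W n"
begin

lemma W_carrier: "x \<in> W n \<Longrightarrow> x \<in> carrier G"
  using openin_W openin_carrier by blast

lemma mult_W: "x \<in> W (Suc n) \<Longrightarrow> y \<in> W (Suc n) \<Longrightarrow> x \<otimes> y \<in> W n"
  using cube_W[OF _ _ one_W, of x n y] by (simp add: W_carrier)

lemma W_Suc_subset: "W (Suc n) \<subseteq> W n"
  using mult_W[OF _ one_W] by (auto simp: W_carrier)

lemma W_antimono: "m \<le> n \<Longrightarrow> W n \<subseteq> W m"
  by (rule lift_Suc_antimono_le[of W]) (rule W_Suc_subset)

definition H where "H = (\<Inter>n. W n)"

lemma H_W: "h \<in> H \<Longrightarrow> h \<in> W n"
  by (simp add: H_def)

lemma subgroup_H: "subgroup H G"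
  by (rule subgroupI) (auto simp: H_def intro: one_W inv_W mult_W W_carrier)

lemma mult_H_W: "x \<in> W (Suc n) \<Longrightarrow> h \<in> H \<Longrightarrow> x \<otimes> h \<in> W n"
  using mult_W H_W by blast

text \<open>The neighbourhood \<open>y W (Suc n)\<close> of \<open>y\<close> meets
  \<open>W (Suc n)\<close> in some \<open>z\<close>, and then \<open>y\<close> is the product of
  \<open>z\<close> and the inverse of \<open>inv y \<otimes> z\<close>, both in
  \<open>W (Suc n)\<close>.\<close>

lemma closure_W:
  assumes "y \<in> carrier G" "\<And>V. openin T V \<Longrightarrow> y \<in> V \<Longrightarrow> V \<inter> W (Suc n) \<noteq> {}"
  shows "y \<in> W n"
proof -
  let ?V = "{z \<in> carrier G. inv y \<otimes> z \<in> W (Suc n)}"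
  have "openin T ?V" using assms(1) openin_W by (intro openin_ltranslate) auto
  moreover have "y \<in> ?V" using assms(1) one_W by simp
  ultimately obtain z where z: "z \<in> carrier G" "inv y \<otimes> z \<in> W (Suc n)" "z \<in> W (Suc n)"
    using assms(2) by blast
  have "z \<otimes> inv (inv y \<otimes> z) \<in> W n" using z by (intro mult_W[OF _ inv_W])
  also have "z \<otimes> inv (inv y \<otimes> z) = y"
    using z(1) assms(1) by (simp add: inv_mult_group m_assoc[symmetric])
  finally show ?thesis .
qed

lemma closedin_H: "closedin T H"
proof -
  have "T closure_of H \<subseteq> H"
  proof
    fix y assume y: "y \<in> T closure_of H"
    have "y \<in> W n" for n
    proof (rule closure_W)
      show "y \<in> carrier G" using y by (simp add: in_closure_of topspace_eq_carrier)
      fix V assume "openin T V" "y \<in> V"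
      with y obtain z where "z \<in> H" "z \<in> V" unfolding in_closure_of by metis
      then show "V \<inter> W (Suc n) \<noteq> {}" using H_W by auto
    qed
    then show "y \<in> H" by (simp add: H_def)
  qed
  moreover have "H \<subseteq> topspace T"
    using subgroup.subset[OF subgroup_H] topspace_eq_carrier by simp
  ultimately show ?thesis using closure_of_subset_eq by blast
qed

section \<open>Products of the neighbourhoods and the Birkhoff-Kakutani norm\<close>

abbreviation weight :: "nat list \<Rightarrow> real" where
  "weight ns \<equiv> (\<Sum>n\<leftarrow>ns. (1/2) ^ n)"

lemma weight_nonneg: "0 \<le> weight ns"
  by (rule sum_list_nonneg) auto

text \<open>The cut is at the entry where the partial sums first reach \<open>c\<close>. Induction
  from the right end finds it: either the list without its last entry already reaches
  \<open>c\<close>, or that last entry is the one.\<close>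

lemma weight_split:
  assumes "0 < c" "c \<le> weight ns"
  shows "\<exists>xs n ys. ns = xs @ n # ys \<and> weight xs < c \<and> c \<le> weight xs + (1/2) ^ n"
  using assms
proof (induction ns rule: rev_induct)
  case (snoc n ns)
  show ?case
  proof (cases "c \<le> weight ns")
    case True
    then obtain xs k ys where "ns = xs @ k # ys" "weight xs < c" "c \<le> weight xs + (1/2) ^ k"
      using snoc by blast
    then show ?thesis by (intro exI[of _ xs] exI[of _ k] exI[of _ "ys @ [n]"]) simp
  next
    case False
    then show ?thesis
      using snoc.prems by (intro exI[of _ ns] exI[of _ n] exI[of _ "[]"]) simp
  qed
qed simp

fun W_prod :: "nat list \<Rightarrow> 'a set" where
  "W_prod [] = {\<one>}"
| "W_prod (n # ns) = W n <#> W_prod ns"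

lemma W_prod_carrier: "W_prod ns \<subseteq> carrier G"
  by (induction ns) (auto simp: set_mult_def W_carrier)

lemma W_prod_append: "W_prod (ms @ ns) = W_prod ms <#> W_prod ns"
proof (induction ms)
  case Nil
  then show ?case using W_prod_carrier[of ns] by (force simp: set_mult_def)
next
  case (Cons m ms)
  have "W m \<subseteq> carrier G" using W_carrier by blast
  then show ?case using Cons W_prod_carrier by (simp add: set_mult_assoc)
qed

lemma W_prod_singleton: "W_prod [n] = W n"
  using W_carrier by (force simp: set_mult_def)

lemma W_prod_rev: "x \<in> W_prod ns \<Longrightarrow> inv x \<in> W_prod (rev ns)"
proof (induction ns arbitrary: x)
  case (Cons n ns)
  then obtain y z where yz: "y \<in> W n" "z \<in> W_prod ns" "x = y \<otimes> z"
    by (auto simp: set_mult_def)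
  then have "inv x = inv z \<otimes> inv y"
    using W_carrier[OF yz(1)] W_prod_carrier[of ns] by (auto simp: inv_mult_group)
  moreover have "inv z \<otimes> inv y \<in> W_prod (rev ns) <#> W_prod [n]"
    using Cons.IH[OF yz(2)] inv_W[OF yz(1)] unfolding W_prod_singleton
    by (auto simp: set_mult_def)
  ultimately show ?case by (simp add: W_prod_append del: W_prod.simps)
qed simp

text \<open>Cutting the product where its weight first reaches half of the bound leaves three
  factors, each of them in \<open>W (Suc m)\<close>.\<close>

lemma W_prod_subset: "weight ns < (1/2) ^ m \<Longrightarrow> W_prod ns \<subseteq> W m"
proof (induction "length ns" arbitrary: ns m rule: less_induct)
  case less
  let ?c = "(1/2) ^ Suc m :: real"
  show ?case
  proof (cases "ns = []")
    case True
    then show ?thesis by (simp add: one_W)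
  next
    case False
    obtain xs n ys where ns: "ns = xs @ n # ys" "weight xs < ?c" "weight ys < ?c"
    proof (cases "?c \<le> weight ns")
      case True
      obtain xs n ys where "ns = xs @ n # ys" "weight xs < ?c" "?c \<le> weight xs + (1/2) ^ n"
        using weight_split[OF _ True] by auto
      \<comment> \<open>The whole list weighs less than twice \<open>?c\<close>, and the part up to
        and including \<open>n\<close> already weighs at least \<open>?c\<close>.\<close>
      moreover from this have "weight ys < ?c"
        using less.prems by simp
      ultimately show ?thesis using that by blast
    next
      case small: False
      \<comment> \<open>If the whole list weighs less than \<open>?c\<close>, any cut will do; the
        left piece is taken empty.\<close>
      obtain n ys where "ns = n # ys" using False by (cases ns) auto
      moreover from this have "weight ys \<le> weight ns" by simp
      then have "weight ys < ?c" using small by linarith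
      ultimately show ?thesis using that[of "[]" n ys] by simp
    qed
    \<comment> \<open>The middle factor is not bounded by \<open>?c\<close>, only strictly by
      \<open>(1/2) ^ m\<close>. Strictness gives \<open>m < n\<close>, which suffices to place
      \<open>W n\<close> inside \<open>W (Suc m)\<close>.\<close>
    have "weight ns = weight xs + ((1/2) ^ n + weight ys)" using ns(1) by simp
    then have "(1/2) ^ n < ((1/2) ^ m :: real)"
      using less.prems weight_nonneg[of xs] weight_nonneg[of ys] by linarith
    then have "m < n"
      by (simp add: power_strict_decreasing_iff)
    then have n: "W n \<subseteq> W (Suc m)" by (intro W_antimono) simp
    have xs: "W_prod xs \<subseteq> W (Suc m)" and ys: "W_prod ys \<subseteq> W (Suc m)"
      using less.hyps[OF _ ns(2)] less.hyps[OF _ ns(3)] ns(1) by auto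
    show ?thesis
    proof
      fix x assume "x \<in> W_prod ns"
      then have "x \<in> W_prod xs <#> (W n <#> W_prod ys)"
        by (simp add: ns(1) W_prod_append)
      then obtain a b c where abc: "a \<in> W_prod xs" "b \<in> W n" "c \<in> W_prod ys"
        and x: "x = a \<otimes> (b \<otimes> c)"
        by (auto simp: set_mult_def)
      have W: "a \<in> W (Suc m)" "b \<in> W (Suc m)" "c \<in> W (Suc m)"
        using abc xs ys n by auto
      then have "x = a \<otimes> b \<otimes> c" unfolding x by (simp add: m_assoc W_carrier)
      then show "x \<in> W m" using cube_W[OF W] by simp
    qed
  qed
qed

text \<open>The Birkhoff-Kakutani pseudonorm: the cheapest factorization, where a factor from
  \<open>W n\<close> costs \<open>(1/2) ^ n\<close>. Concatenating factorizations gives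
  subadditivity and reversing them gives symmetry; up to the boundary value, its balls of radius
  \<open>(1/2) ^ n\<close> are the \<open>W n\<close>.\<close>

definition gnorm :: "'a \<Rightarrow> real" where
  "gnorm x = (INF ns\<in>{ns. x \<in> W_prod ns}. weight ns)"

lemma bdd_below_weight: "bdd_below (weight ` A)"
  by (rule bdd_belowI2[of _ 0]) (rule weight_nonneg)

lemma gnorm_le: "x \<in> W_prod ns \<Longrightarrow> gnorm x \<le> weight ns"
  unfolding gnorm_def by (rule cINF_lower[OF bdd_below_weight]) simp

lemma gnorm_le_power: "x \<in> W n \<Longrightarrow> gnorm x \<le> (1/2) ^ n"
  using gnorm_le[of x "[n]"] unfolding W_prod_singleton by simp

text \<open>The one-letter list \<open>[0]\<close> always qualifies, so the infimum in
  \<open>gnorm\<close> ranges over a nonempty set.\<close>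

lemma W_prod_nonempty: "x \<in> carrier G \<Longrightarrow> {ns. x \<in> W_prod ns} \<noteq> {}"
  using W_prod_singleton[of 0] W_0 by blast

lemma gnorm_less_obtain:
  assumes "x \<in> carrier G" "gnorm x < c"
  obtains ns where "x \<in> W_prod ns" "weight ns < c"
  using assms cINF_less_iff[OF W_prod_nonempty bdd_below_weight] unfolding gnorm_def by auto

lemma gnorm_nonneg: "x \<in> carrier G \<Longrightarrow> 0 \<le> gnorm x"
  unfolding gnorm_def by (rule cINF_greatest[OF W_prod_nonempty weight_nonneg])

lemma gnorm_less_power: "x \<in> carrier G \<Longrightarrow> gnorm x < (1/2) ^ n \<Longrightarrow> x \<in> W n"
  using gnorm_less_obtain W_prod_subset by (metis subsetD)

lemma gnorm_eq_0_iff: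
  assumes "x \<in> carrier G"
  shows "gnorm x = 0 \<longleftrightarrow> x \<in> H"
proof
  assume "gnorm x = 0"
  then show "x \<in> H" unfolding H_def using gnorm_less_power[OF assms] by simp
next
  assume x: "x \<in> H"
  have "gnorm x \<le> e" if e: "e > 0" for e
  proof -
    obtain n where "(1/2) ^ n < e" using real_arch_pow_inv[of e "1/2"] e by auto
    then show ?thesis using gnorm_le_power[OF H_W[OF x], of n] by linarith
  qed
  then have "gnorm x \<le> 0" by (rule dense_ge)
  then show "gnorm x = 0" using gnorm_nonneg[OF assms] by simp
qed

lemma gnorm_mult:
  assumes "x \<in> carrier G" "y \<in> carrier G"
  shows "gnorm (x \<otimes> y) \<le> gnorm x + gnorm y"
proof (rule field_le_epsilon)
  fix e :: real assume "e > 0"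
  then have "gnorm x < gnorm x + e/2" "gnorm y < gnorm y + e/2" by auto
  then obtain ms ns where "x \<in> W_prod ms" "weight ms < gnorm x + e/2"
    "y \<in> W_prod ns" "weight ns < gnorm y + e/2"
    using gnorm_less_obtain assms by metis
  moreover from this have "x \<otimes> y \<in> W_prod (ms @ ns)"
    unfolding W_prod_append set_mult_def by blast
  ultimately show "gnorm (x \<otimes> y) \<le> gnorm x + gnorm y + e"
    using gnorm_le[of "x \<otimes> y" "ms @ ns"] by simp
qed

lemma gnorm_inv_le:
  assumes "x \<in> carrier G"
  shows "gnorm (inv x) \<le> gnorm x"
  unfolding gnorm_def[of x]
proof (rule cINF_greatest[OF W_prod_nonempty[OF assms]])
  fix ns assume "ns \<in> {ns. x \<in> W_prod ns}"
  then have "gnorm (inv x) \<le> weight (rev ns)" by (intro gnorm_le W_prod_rev) simp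
  then show "gnorm (inv x) \<le> weight ns" by (simp add: rev_map[symmetric])
qed

lemma gnorm_inv: "x \<in> carrier G \<Longrightarrow> gnorm (inv x) = gnorm x"
  using gnorm_inv_le[of x] gnorm_inv_le[of "inv x"] by simp

section \<open>The induced metric on cosets\<close>

abbreviation p where "p \<equiv> coset_map G H"

lemma p_eq_iff: "x \<in> carrier G \<Longrightarrow> y \<in> carrier G \<Longrightarrow> p x = p y \<longleftrightarrow> inv x \<otimes> y \<in> H"
  by (rule coset_map_eq_iff[OF subgroup_H])

text \<open>Changing representatives multiplies \<open>inv x' \<otimes> y'\<close> on both sides by
  elements of \<open>H\<close>, which have norm 0. Used in both directions, this makes the distance
  of cosets well defined.\<close>

lemma gnorm_coset_le:
  assumes "x \<in> carrier G" "y \<in> carrier G" "x' \<in> carrier G" "y' \<in> carrier G"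
    and "p x = p x'" "p y = p y'"
  shows "gnorm (inv x \<otimes> y) \<le> gnorm (inv x' \<otimes> y')"
proof -
  have "inv x \<otimes> y = (inv x \<otimes> x') \<otimes> ((inv x' \<otimes> y') \<otimes> (inv y' \<otimes> y))"
    using assms(1-4) by (simp add: m_assoc mult_inv_mult_cancel)
  also have "gnorm \<dots> \<le> gnorm (inv x \<otimes> x') + (gnorm (inv x' \<otimes> y') + gnorm (inv y' \<otimes> y))"
    using assms(1-4) by (intro order_trans[OF gnorm_mult] add_left_mono gnorm_mult) auto
  also have "\<dots> = gnorm (inv x' \<otimes> y')"
    using assms p_eq_iff[of x x'] p_eq_iff[of y' y] gnorm_eq_0_iff[of "inv x \<otimes> x'"]
      gnorm_eq_0_iff[of "inv y' \<otimes> y"] by simp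
  finally show ?thesis .
qed

definition rep :: "'a set \<Rightarrow> 'a" where
  "rep A = (SOME x. x \<in> carrier G \<and> p x = A)"

text \<open>The value 0 off the coset space is there because \<open>Metric_space\<close> demands
  nonnegativity and symmetry for all arguments, not only for points of the space.\<close>

definition qdist :: "'a set \<Rightarrow> 'a set \<Rightarrow> real" where
  "qdist A B = (if A \<in> p ` carrier G \<and> B \<in> p ` carrier G then gnorm (inv rep A \<otimes> rep B) else 0)"

lemma qdist_coset_map:
  assumes "x \<in> carrier G" "y \<in> carrier G"
  shows "qdist (p x) (p y) = gnorm (inv x \<otimes> y)"
proof -
  have "rep (p z) \<in> carrier G \<and> p (rep (p z)) = p z" if "z \<in> carrier G" for z
    unfolding rep_def by (rule someI_ex) (use that in blast)
  then show ?thesis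
    unfolding qdist_def using assms by (auto intro!: antisym gnorm_coset_le)
qed

lemma Metric_space_qdist: "Metric_space (p ` carrier G) qdist"
proof
  fix A B
  show "0 \<le> qdist A B"
  proof (cases "A \<in> p ` carrier G \<and> B \<in> p ` carrier G")
    case True
    then obtain x y where "x \<in> carrier G" "A = p x" "y \<in> carrier G" "B = p y"
      by (elim conjE imageE)
    then show ?thesis by (simp add: qdist_coset_map gnorm_nonneg)
  next
    case False
    then show ?thesis by (simp only: qdist_def if_False order_refl)
  qed
  show "qdist A B = qdist B A"
  proof (cases "A \<in> p ` carrier G \<and> B \<in> p ` carrier G")
    case True
    then obtain x y where "x \<in> carrier G" "A = p x" "y \<in> carrier G" "B = p y"
      by (elim conjE imageE)
    then show ?thesis
      using gnorm_inv[of "inv x \<otimes> y"] by (simp add: qdist_coset_map inv_mult_group)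
  next
    case False
    then have "\<not> (B \<in> p ` carrier G \<and> A \<in> p ` carrier G)" by blast
    with False show ?thesis by (simp only: qdist_def if_False order_refl)
  qed
next
  fix A B assume "A \<in> p ` carrier G" "B \<in> p ` carrier G"
  then obtain x y where "x \<in> carrier G" "A = p x" "y \<in> carrier G" "B = p y"
    by (elim imageE)
  then show "qdist A B = 0 \<longleftrightarrow> A = B"
    by (simp add: qdist_coset_map gnorm_eq_0_iff p_eq_iff)
next
  fix A B C assume "A \<in> p ` carrier G" "B \<in> p ` carrier G" "C \<in> p ` carrier G"
  then obtain x y z where xyz: "x \<in> carrier G" "A = p x" "y \<in> carrier G" "B = p y"
    "z \<in> carrier G" "C = p z"
    by (elim imageE)
  have "inv x \<otimes> z = (inv x \<otimes> y) \<otimes> (inv y \<otimes> z)"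
    using xyz by (simp add: m_assoc mult_inv_mult_cancel)
  then show "qdist A C \<le> qdist A B + qdist B C"
    using xyz gnorm_mult[of "inv x \<otimes> y" "inv y \<otimes> z"] by (simp add: qdist_coset_map)
qed

end

section \<open>The quotient when the neighbourhoods form a base at the subgroup\<close>

locale nested_nbhds_base = nested_nbhds +
  assumes base: "\<And>U. openin T U \<Longrightarrow> H \<subseteq> U \<Longrightarrow> \<exists>n. W n \<subseteq> U"
begin

lemma countable_character_H: "countable_character_in T H"
  unfolding countable_character_in_def
proof
  show "H \<subseteq> topspace T" using closedin_H by (rule closedin_subset)
  show "\<exists>U::nat \<Rightarrow> 'a set. (\<forall>n. openin T (U n) \<and> H \<subseteq> U n) \<and>
      (\<forall>V. openin T V \<and> H \<subseteq> V \<longrightarrow> (\<exists>n. U n \<subseteq> V))"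
    using openin_W H_W base by (intro exI[of _ W]) blast
qed

text \<open>Left translation carries the base at \<open>H\<close> to a base at the coset of
  \<open>x\<close>: an open set containing \<open>x H\<close> contains some
  \<open>x W n\<close>.\<close>

lemma W_translate_subset:
  assumes U: "openin T U" and x: "x \<in> carrier G" and xH: "\<And>h. h \<in> H \<Longrightarrow> x \<otimes> h \<in> U"
  shows "\<exists>n. \<forall>w\<in>W n. x \<otimes> w \<in> U"
proof -
  have "H \<subseteq> {w \<in> carrier G. x \<otimes> w \<in> U}" using xH H_W W_carrier by blast
  then obtain n where "W n \<subseteq> {w \<in> carrier G. x \<otimes> w \<in> U}"
    using base[OF openin_ltranslate[OF x U]] by blast
  then show ?thesis by blast
qed

lemma p_mult_H: "x \<in> carrier G \<Longrightarrow> h \<in> H \<Longrightarrow> p (x \<otimes> h) = p x"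
  using p_eq_iff[of x "x \<otimes> h"] W_carrier[OF H_W, of h] by (simp add: m_assoc[symmetric])

lemma W_translate_preimage_subset:
  assumes "openin (coset_topology G T H) U" "x \<in> carrier G" "p x \<in> U"
  shows "\<exists>n. \<forall>w\<in>W n. p (x \<otimes> w) \<in> U"
proof -
  have "\<exists>n. \<forall>w\<in>W n. x \<otimes> w \<in> {x \<in> carrier G. p x \<in> U}"
  proof (rule W_translate_subset)
    show "openin T {x \<in> carrier G. p x \<in> U}" using assms by (simp add: openin_coset_topology)
    show "x \<otimes> h \<in> {x \<in> carrier G. p x \<in> U}" if "h \<in> H" for h
      using assms that p_mult_H W_carrier[OF H_W[OF that]] by simp
  qed (fact assms)
  then show ?thesis by blast
qed

text \<open>The metric topology is shown equal to the quotient topology. A quotient-open set around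
  \<open>p x\<close> contains \<open>p (x W n)\<close> for some \<open>n\<close>, hence the ball of
  radius \<open>(1/2) ^ n\<close>; conversely a ball of radius \<open>r\<close> contains
  \<open>p (x W n)\<close> as soon as \<open>(1/2) ^ n < r\<close>.\<close>

lemma metrizable_coset_topology: "metrizable_space (coset_topology G T H)"
proof -
  interpret Q: Metric_space "p ` carrier G" qdist by (rule Metric_space_qdist)
  have "openin (coset_topology G T H) U \<longleftrightarrow> openin Q.mtopology U" for U
  proof
    assume U: "openin (coset_topology G T H) U"
    show "openin Q.mtopology U"
      unfolding Q.openin_mtopology
    proof (intro conjI allI impI)
      show UG: "U \<subseteq> p ` carrier G" using U by (simp add: openin_coset_topology)
      fix A assume "A \<in> U"
      then obtain x where x: "x \<in> carrier G" "A = p x" using UG by blast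
      obtain n where n: "\<forall>w\<in>W n. p (x \<otimes> w) \<in> U"
        using W_translate_preimage_subset[OF U x(1)] x(2) \<open>A \<in> U\<close> by blast
      have "p y \<in> U" if y: "y \<in> carrier G" "qdist (p x) (p y) < (1/2) ^ n" for y
      proof -
        have "inv x \<otimes> y \<in> W n"
          using y x(1) by (intro gnorm_less_power) (auto simp: qdist_coset_map)
        then have "p (x \<otimes> (inv x \<otimes> y)) \<in> U" using n by blast
        then show ?thesis using x(1) y(1) by (simp add: mult_inv_mult_cancel)
      qed
      then show "\<exists>r>0. Q.mball A r \<subseteq> U"
        unfolding x(2) by (intro exI[of _ "(1/2) ^ n"]) auto
    qed
  next
    assume U: "openin Q.mtopology U"
    then have UG: "U \<subseteq> p ` carrier G"
      unfolding Q.openin_mtopology by blast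
    have "\<exists>V. openin T V \<and> x \<in> V \<and> V \<subseteq> {x \<in> carrier G. p x \<in> U}"
      if x: "x \<in> carrier G" "p x \<in> U" for x
    proof -
      obtain r where r: "r > 0" "Q.mball (p x) r \<subseteq> U"
        using U x(2) unfolding Q.openin_mtopology by blast
      obtain n where n: "(1/2) ^ n < r" using real_arch_pow_inv[of r "1/2"] r(1) by auto
      let ?V = "{y \<in> carrier G. inv x \<otimes> y \<in> W n}"
      have "p y \<in> U" if y: "y \<in> ?V" for y
      proof -
        have "gnorm (inv x \<otimes> y) < r"
          using gnorm_le_power[of "inv x \<otimes> y" n] y n by simp
        then have "p y \<in> Q.mball (p x) r" using x(1) y by (simp add: qdist_coset_map)
        then show ?thesis using r(2) by blast
      qed
      moreover have "openin T ?V" using x(1) openin_W by (intro openin_ltranslate) auto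
      moreover have "x \<in> ?V" using x(1) one_W by simp
      ultimately show ?thesis by (intro exI[of _ ?V]) auto
    qed
    then have "openin T {x \<in> carrier G. p x \<in> U}"
      by (subst openin_subopen) auto
    then show "openin (coset_topology G T H) U" using UG by (simp add: openin_coset_topology)
  qed
  then have "coset_topology G T H = Q.mtopology"
    by (simp add: topology_eq)
  then show ?thesis by (simp add: Q.metrizable_space_mtopology)
qed

lemma separable_coset_topology:
  assumes "omega_narrow G T"
  shows "separable_space (coset_topology G T H)"
proof -
  have "\<exists>A. countable A \<and> A \<subseteq> carrier G \<and> A <#> W n = carrier G" for n
    using assms[unfolded omega_narrow_def, rule_format, OF conjI, OF openin_W one_W] .
  then obtain A where A: "\<And>n. countable (A n)" "\<And>n. A n \<subseteq> carrier G"
    "\<And>n. A n <#> W n = carrier G"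
    by metis
  \<comment> \<open>One countable set per \<open>W n\<close>, since the \<open>n\<close> needed
    depends on the open set to be hit.\<close>
  define D where "D = (\<Union>n. A n)"
  have DG: "D \<subseteq> carrier G" using A(2) unfolding D_def by blast
  have dense: "\<exists>a\<in>D. p a \<in> U" if U: "openin (coset_topology G T H) U" and x: "x \<in> carrier G" "p x \<in> U" for x U
  proof -
    obtain n where n: "\<forall>w\<in>W n. p (x \<otimes> w) \<in> U"
      using W_translate_preimage_subset[OF U x] by blast
    obtain a w where a: "a \<in> A n" "w \<in> W n" "x = a \<otimes> w"
      using x(1) unfolding A(3)[of n, symmetric] by (auto simp: set_mult_def)
    \<comment> \<open>Symmetry of \<open>W n\<close> turns \<open>x \<in> a W n\<close> into
      \<open>a \<in> x W n\<close>, and the latter set is mapped into \<open>U\<close>.\<close>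
    have "x \<otimes> inv w = a"
      using a(3) subsetD[OF A(2) a(1)] W_carrier[OF a(2)] by (simp add: m_assoc)
    then have "p a \<in> U" using n inv_W[OF a(2)] by metis
    then show ?thesis using a(1) unfolding D_def by blast
  qed
  have "countable (p ` D)" using A(1) unfolding D_def by blast
  moreover have "p ` D \<subseteq> topspace (coset_topology G T H)"
    using DG by (auto simp: topspace_coset)
  moreover have "(coset_topology G T H) closure_of (p ` D) = topspace (coset_topology G T H)"
    unfolding dense_intersects_open
  proof (intro allI impI)
    fix U assume U: "openin (coset_topology G T H) U \<and> U \<noteq> {}"
    then obtain x where "x \<in> carrier G" "p x \<in> U"
      by (auto simp: openin_coset_topology)
    then show "p ` D \<inter> U \<noteq> {}" using dense U by blast
  qed
  ultimately show ?thesis unfolding separable_space_def by blast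
qed

text \<open>If the coset of \<open>x\<close> misses \<open>C\<close>, so does some
  \<open>x W n\<close>. Then \<open>x W (Suc n)\<close> misses the saturation of \<open>C\<close>,
  because \<open>W (Suc n) H\<close> is contained in \<open>W n\<close>; so the complement of the
  saturation is open.\<close>

lemma closed_map_p: "closed_map T (coset_topology G T H) p"
  unfolding closed_map_def
proof (intro allI impI)
  fix C assume C: "closedin T C"
  then have CG: "C \<subseteq> carrier G" using closedin_subset topspace_eq_carrier by metis
  have "\<exists>V. openin T V \<and> x \<in> V \<and> V \<subseteq> {x \<in> carrier G. p x \<notin> p ` C}"
    if x: "x \<in> carrier G" "p x \<notin> p ` C" for x
  proof -
    have "\<exists>n. \<forall>w\<in>W n. x \<otimes> w \<in> topspace T - C"
    proof (rule W_translate_subset)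
      show "x \<otimes> h \<in> topspace T - C" if "h \<in> H" for h
        using x p_mult_H[OF x(1) that] W_carrier[OF H_W[OF that]]
        by (metis Diff_iff image_eqI m_closed topspace_eq_carrier)
    qed (use C x in auto)
    then obtain n where n: "\<And>w. w \<in> W n \<Longrightarrow> x \<otimes> w \<notin> C" by blast
    let ?V = "{y \<in> carrier G. inv x \<otimes> y \<in> W (Suc n)}"
    have "p y \<notin> p ` C" if y: "y \<in> ?V" for y
    proof
      assume "p y \<in> p ` C"
      then obtain c where c: "c \<in> C" "p y = p c" by blast
      have cG: "c \<in> carrier G" using c(1) CG by blast
      have "inv y \<otimes> c \<in> H" using p_eq_iff[of y c] c(2) cG y by simp
      then have "(inv x \<otimes> y) \<otimes> (inv y \<otimes> c) \<in> W n" using y by (simp add: mult_H_W)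
      then have "x \<otimes> ((inv x \<otimes> y) \<otimes> (inv y \<otimes> c)) \<notin> C" by (rule n)
      moreover have "x \<otimes> ((inv x \<otimes> y) \<otimes> (inv y \<otimes> c)) = c"
        using x(1) y cG by (simp add: m_assoc mult_inv_mult_cancel)
      ultimately show False using c(1) by simp
    qed
    moreover have "openin T ?V" using x(1) openin_W by (intro openin_ltranslate) auto
    moreover have "x \<in> ?V" using x(1) one_W by simp
    ultimately show ?thesis by (intro exI[of _ ?V]) auto
  qed
  then have "openin T {x \<in> carrier G. p x \<notin> p ` C}"
    by (subst openin_subopen) auto
  moreover have "{x \<in> carrier G. p x \<in> p ` carrier G - p ` C} = {x \<in> carrier G. p x \<notin> p ` C}"
    by blast
  ultimately show "closedin (coset_topology G T H) (p ` C)"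
    using CG by (auto simp: closedin_def topspace_coset openin_coset_topology)
qed

text \<open>Each fibre is a left translate of \<open>H\<close>, hence inherits its sequential
  compactness.\<close>

lemma sequential_perfect_map_p:
  assumes "sequentially_compactin T H"
  shows "sequential_perfect_map T (coset_topology G T H) p"
  unfolding sequential_perfect_map_def
proof (intro conjI ballI closed_map_p)
  show "continuous_map T (coset_topology G T H) p"
    unfolding coset_topology_def
    by (rule quotient_imp_continuous_map[OF quotient_map_quotient_topology])
  fix A assume "A \<in> topspace (coset_topology G T H)"
  then obtain x where x: "x \<in> carrier G" "A = p x" by (auto simp: topspace_coset)
  have "{y \<in> topspace T. p y = A} = (\<lambda>h. x \<otimes> h) ` H"
  proof (intro equalityI subsetI)
    fix y assume "y \<in> {y \<in> topspace T. p y = A}"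
    then have y: "y \<in> carrier G" "p x = p y" using x by (auto simp: topspace_eq_carrier)
    then show "y \<in> (\<lambda>h. x \<otimes> h) ` H"
      using x(1) p_eq_iff[of x y] by (intro image_eqI[of _ _ "inv x \<otimes> y"])
        (auto simp: mult_inv_mult_cancel)
  next
    fix y assume "y \<in> (\<lambda>h. x \<otimes> h) ` H"
    then obtain h where "h \<in> H" "y = x \<otimes> h" by blast
    then show "y \<in> {y \<in> topspace T. p y = A}"
      using x p_mult_H[of x h] W_carrier[OF H_W, of h] by (simp add: topspace_eq_carrier)
  qed
  then show "sequentially_compactin T {y \<in> topspace T. p y = A}"
    using sequentially_compactin_continuous_image[OF continuous_map_lmult[OF x(1)] assms] by simp
qed

end


section \<open>Omega-narrow strict q-groups\<close>

text \<open>\<open>Suc n\<close> handles the pair \<open>(i, j) = prod_decode n\<close>, where \<open>i \<le> n\<close>; so every \<open>C (W i) j\<close>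
  eventually contains a member of the sequence.\<close>

function diag_seq ::
  "'a set \<Rightarrow> ('a set \<Rightarrow> 'a set) \<Rightarrow> ('a set \<Rightarrow> nat \<Rightarrow> 'a set) \<Rightarrow> (nat \<Rightarrow> 'a set) \<Rightarrow> nat \<Rightarrow> 'a set" where
  "diag_seq A S C U 0 = A"
| "diag_seq A S C U (Suc n) =
     S (diag_seq A S C U n \<inter> U n \<inter>
        C (diag_seq A S C U (fst (prod_decode n))) (snd (prod_decode n)))"
  by pat_completeness auto
termination
proof (relation "measure (\<lambda>(A, S, C, U, n). n)")
  show "((A, S, C, U, fst (prod_decode n)), A, S, C, U, Suc n) \<in> measure (\<lambda>(A, S, C, U, n). n)"
    for A :: "'a set" and S C U n
    using le_prod_encode_1[of "fst (prod_decode n)" "snd (prod_decode n)"] by simp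
qed auto

lemma (in topological_group) omega_narrow_nested_nbhds:
  assumes nar: "omega_narrow G T" and U: "\<And>n. openin T (U n)" "\<And>n. \<one> \<in> U n"
  obtains W where "nested_nbhds G T W" "\<And>n. W (Suc n) \<subseteq> U n"
    "\<And>n x. x \<in> carrier G \<Longrightarrow> \<exists>m. \<forall>h\<in>W m. x \<otimes> h \<otimes> inv x \<in> W n"
proof -
  define nb where "nb V \<longleftrightarrow> openin T V \<and> \<one> \<in> V" for V
  have "\<exists>V. nb V \<and> (\<forall>x\<in>V. inv x \<in> V) \<and> (\<forall>x\<in>V. \<forall>y\<in>V. \<forall>z\<in>V. x \<otimes> y \<otimes> z \<in> A)" if "nb A" for A
  proof -
    from that have A: "openin T A" "\<one> \<in> A" by (auto simp: nb_def)
    show ?thesis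
      by (rule symmetric_nbhd_cube[OF A], unfold nb_def) (intro exI conjI ballI)
  qed
  \<comment> \<open>\<open>S\<close> chooses a symmetric neighbourhood with cube inside its
    argument, and \<open>C\<close> below a countable family absorbing all conjugations. Both are
    controlled only at open neighbourhoods of the identity, hence the predicate
    \<open>nb\<close>.\<close>
  then obtain S where S: "\<And>A. nb A \<Longrightarrow> nb (S A)" "\<And>A x. nb A \<Longrightarrow> x \<in> S A \<Longrightarrow> inv x \<in> S A"
    "\<And>A x y z. nb A \<Longrightarrow> x \<in> S A \<Longrightarrow> y \<in> S A \<Longrightarrow> z \<in> S A \<Longrightarrow> x \<otimes> y \<otimes> z \<in> A"
    by metis
  have "\<exists>C. (\<forall>i. nb (C i)) \<and> (\<forall>x\<in>carrier G. \<exists>i::nat. \<forall>h\<in>C i. x \<otimes> h \<otimes> inv x \<in> A)" if "nb A" for A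
  proof -
    from that have A: "openin T A" "\<one> \<in> A" by (auto simp: nb_def)
    show ?thesis
    proof (rule omega_narrow_balanced[OF nar A])
      fix C :: "nat \<Rightarrow> 'a set"
      assume "\<And>i. openin T (C i)" "\<And>i. \<one> \<in> C i"
        "\<And>x. x \<in> carrier G \<Longrightarrow> \<exists>i. \<forall>h\<in>C i. x \<otimes> h \<otimes> inv x \<in> A"
      then show ?thesis by (intro exI[of _ C] conjI allI ballI) (simp_all add: nb_def)
    qed
  qed
  then obtain C where C: "\<And>A i. nb A \<Longrightarrow> nb (C A i)"
    "\<And>A x. nb A \<Longrightarrow> x \<in> carrier G \<Longrightarrow> \<exists>i::nat. \<forall>h\<in>C A i. x \<otimes> h \<otimes> inv x \<in> A"
    by metis
  define W where "W = diag_seq (carrier G) S C U"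
  define R where "R n = W n \<inter> U n \<inter> C (W (fst (prod_decode n))) (snd (prod_decode n))" for n
  have W_0: "W 0 = carrier G" and W_Suc: "W (Suc n) = S (R n)" for n
    by (simp_all add: W_def R_def)
  have nb_Int: "nb (A \<inter> B)" if "nb A" "nb B" for A B
    using that unfolding nb_def by auto
  \<comment> \<open>Strong induction, since \<open>W (Suc k)\<close> refers to a member at an
    arbitrary index up to \<open>k\<close> through \<open>prod_decode\<close>.\<close>
  have nb_W: "nb (W n)" for n
  proof (induction n rule: less_induct)
    case (less n)
    show ?case
    proof (cases n)
      case 0
      then show ?thesis by (simp add: W_0 nb_def)
    next
      case (Suc k)
      have "fst (prod_decode k) \<le> k"
        using le_prod_encode_1[of "fst (prod_decode k)" "snd (prod_decode k)"] by simp
      then have "nb (R k)"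
        unfolding R_def using less Suc U by (intro nb_Int C) (auto simp: nb_def)
      then show ?thesis using S(1) Suc W_Suc by simp
    qed
  qed
  have nb_R: "nb (R n)" for n
    unfolding R_def using nb_W U by (intro nb_Int C) (auto simp: nb_def)
  have sub: "W (Suc n) \<subseteq> R n" for n
  proof
    fix x assume x: "x \<in> W (Suc n)"
    have one: "\<one> \<in> W (Suc n)" and "x \<in> carrier G"
      using nb_W x openin_carrier unfolding nb_def by blast+
    then show "x \<in> R n"
      \<comment> \<open>\<open>x\<close> is the cube product of \<open>x\<close>,
        \<open>\<one>\<close> and \<open>\<one>\<close>.\<close>
      using S(3)[OF nb_R, of x n \<one> \<one>] x unfolding W_Suc by simp
  qed
  show thesis
  proof
    show "nested_nbhds G T W"
    proof
      show "W 0 = carrier G" by (fact W_0)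
      show "openin T (W n)" "\<one> \<in> W n" for n using nb_W by (auto simp: nb_def)
      show "inv x \<in> W n" if "x \<in> W n" for n x
        using that S(2)[OF nb_R] by (cases n) (auto simp: W_0 W_Suc)
      show "x \<otimes> y \<otimes> z \<in> W n" if "x \<in> W (Suc n)" "y \<in> W (Suc n)" "z \<in> W (Suc n)" for n x y z
        using S(3)[OF nb_R, of x n y z] that unfolding W_Suc R_def by blast
    qed
    show "W (Suc n) \<subseteq> U n" for n using sub unfolding R_def by blast
    fix n x assume "x \<in> carrier G"
    then obtain i where i: "\<forall>h\<in>C (W n) i. x \<otimes> h \<otimes> inv x \<in> W n" using C(2)[OF nb_W] by blast
    have "W (Suc (prod_encode (n, i))) \<subseteq> C (W n) i"
      using sub[of "prod_encode (n, i)"] unfolding R_def by auto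
    then show "\<exists>m. \<forall>h\<in>W m. x \<otimes> h \<otimes> inv x \<in> W n" using i by blast
  qed
qed

text \<open>A sequence witnessing that no \<open>W n\<close> fits into \<open>V\<close> would accumulate at a point of \<open>H\<close>.\<close>

lemma (in nested_nbhds) nested_nbhds_base_of_q_sequence:
  assumes q: "q_sequence_at T \<one> U" and sub: "\<And>n. W (Suc n) \<subseteq> U n"
  shows "nested_nbhds_base G T W"
proof
  fix V assume V: "openin T V" "H \<subseteq> V"
  show "\<exists>n. W n \<subseteq> V"
  proof (rule ccontr)
    assume "\<nexists>n. W n \<subseteq> V"
    \<comment> \<open>The index \<open>Suc n\<close> matters: \<open>W (Suc n)\<close> is contained
      in \<open>U n\<close>, so the sequence is admissible for the q-sequence.\<close>
    then have "\<forall>n. \<exists>x. x \<in> W (Suc n) \<and> x \<notin> V" by blast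
    then obtain s where s: "\<And>n. s n \<in> W (Suc n)" "\<And>n. s n \<notin> V" by metis
    have "\<forall>n. s n \<in> U n" using s(1) sub by blast
    then obtain y where y: "accumulation_point_of_seq T s y"
      using q unfolding q_sequence_at_def by blast
    have "y \<in> W n" for n
    proof (rule closure_W)
      show "y \<in> carrier G"
        using y topspace_eq_carrier unfolding accumulation_point_of_seq_def by simp
      fix N assume "openin T N" "y \<in> N"
      then have "infinite {k. s k \<in> N}" using y unfolding accumulation_point_of_seq_def by blast
      then obtain k where "k \<ge> n" "s k \<in> N" unfolding infinite_nat_iff_unbounded_le by blast
      moreover from this have "s k \<in> W (Suc n)" using s(1)[of k] W_antimono[of "Suc n" "Suc k"] by auto
      ultimately show "N \<inter> W (Suc n) \<noteq> {}" by blast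
    qed
    then have "y \<in> V" using V(2) unfolding H_def by blast
    then have "infinite {k. s k \<in> V}" using y V(1) unfolding accumulation_point_of_seq_def by blast
    then show False using s(2) by simp
  qed
qed

text \<open>An element of \<open>H\<close> lies in every \<open>W m\<close>, so by the hypothesis
  its conjugates lie in every \<open>W n\<close>.\<close>

lemma (in nested_nbhds) normal_H:
  assumes "\<And>n x. x \<in> carrier G \<Longrightarrow> \<exists>m. \<forall>h\<in>W m. x \<otimes> h \<otimes> inv x \<in> W n"
  shows "H \<lhd> G"
proof (rule normal_invI[OF subgroup_H])
  fix x h assume "x \<in> carrier G" "h \<in> H"
  then show "x \<otimes> h \<otimes> inv x \<in> H" using assms[of x] H_W unfolding H_def by blast
qed

lemma (in topological_group) omega_narrow_strict_q_imp:
  assumes nar: "omega_narrow G T" and q: "strict_q_space T" and O: "openin T O'" "\<one> \<in> O'"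
  shows "\<exists>H. H \<lhd> G \<and> closedin T H \<and> sequentially_compactin T H \<and>
           countable_character_in T H \<and> H \<subseteq> O' \<and>
           sequential_perfect_map T (coset_topology G T H) (coset_map G H) \<and>
           separable_space (coset_topology G T H) \<and>
           metrizable_space (coset_topology G T H)"
proof -
  have "strict_q_point T \<one>" using q by (simp add: strict_q_space_def topspace_eq_carrier)
  then obtain U where U: "q_sequence_at T \<one> U" "sequentially_compactin T (\<Inter>n. U n)"
    unfolding strict_q_point_def by blast
  \<comment> \<open>Cutting \<open>U n\<close> down by \<open>O'\<close> forces \<open>H\<close>
    into \<open>O'\<close>; the base property is still derived from the original q-sequence
    \<open>U\<close>.\<close>
  then have UO: "openin T (U n \<inter> O')" "\<one> \<in> U n \<inter> O'" for n
    using O unfolding q_sequence_at_def by auto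
  obtain W where W: "nested_nbhds G T W" "\<And>n. W (Suc n) \<subseteq> U n \<inter> O'"
    "\<And>n x. x \<in> carrier G \<Longrightarrow> \<exists>m. \<forall>h\<in>W m. x \<otimes> h \<otimes> inv x \<in> W n"
    by (rule omega_narrow_nested_nbhds[OF nar UO]) (rule that)
  interpret nested_nbhds G T W by fact
  interpret nested_nbhds_base G T W
    by (rule nested_nbhds_base_of_q_sequence[OF U(1)]) (use W(2) in blast)
  have HU: "H \<subseteq> U n \<inter> O'" for n using H_W[of _ "Suc n"] W(2)[of n] by blast
  then have "H \<subseteq> (\<Inter>n. U n)" by blast
  then have "sequentially_compactin T H"
    by (rule sequentially_compactin_closed_subset[OF U(2) closedin_H])
  moreover have "H \<subseteq> O'" using HU by blast
  ultimately show ?thesis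
    using normal_H[OF W(3)] closedin_H countable_character_H sequential_perfect_map_p
      separable_coset_topology[OF nar] metrizable_coset_topology by blast
qed

section \<open>From separable quotients to omega-narrowness\<close>

lemma (in topological_group) openin_coset_map_image:
  assumes H: "subgroup H G" and U: "openin T U"
  shows "openin (coset_topology G T H) (coset_map G H ` U)"
proof -
  interpret H: subgroup H G by fact
  have UG: "U \<subseteq> carrier G" using U openin_carrier by blast
  \<comment> \<open>The saturation of \<open>U\<close> is the union of its right translates by
    elements of \<open>H\<close>, which makes the quotient map open.\<close>
  have "{x \<in> carrier G. coset_map G H x \<in> coset_map G H ` U} =
      (\<Union>h\<in>H. {x \<in> carrier G. x \<otimes> h \<in> U})" (is "?L = ?R")
  proof (intro equalityI subsetI)
    fix x assume "x \<in> ?L"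
    then obtain y where y: "x \<in> carrier G" "y \<in> U" "coset_map G H x = coset_map G H y" by blast
    then have "inv x \<otimes> y \<in> H" "x \<otimes> (inv x \<otimes> y) = y"
      using coset_map_eq_iff[OF H, of x y] UG by (auto intro: mult_inv_mult_cancel)
    then show "x \<in> ?R" using y by (intro UN_I[of "inv x \<otimes> y"]) auto
  next
    fix x assume "x \<in> ?R"
    then obtain h where h: "h \<in> H" "x \<in> carrier G" "x \<otimes> h \<in> U" by blast
    then have "coset_map G H x = coset_map G H (x \<otimes> h)"
      using coset_map_eq_iff[OF H, of x "x \<otimes> h"] H.mem_carrier[OF h(1)]
      by (simp add: m_assoc[symmetric])
    then show "x \<in> ?L" using h by blast
  qed
  moreover have "openin T {x \<in> carrier G. x \<otimes> h \<in> U}" if "h \<in> H" for h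
    using H.mem_carrier[OF that] U
    by (intro openin_preimage continuous_map_mult) (auto simp: topspace_eq_carrier)
  ultimately show ?thesis using UG by (auto simp: openin_coset_topology)
qed

text \<open>Take \<open>W\<close> with \<open>W W\<close> inside \<open>V\<close>, a subgroup
  \<open>H\<close> inside \<open>W\<close>, and a countable \<open>A\<close> with dense image in the
  cosets. Every \<open>x\<close> then lies in \<open>a H W\<close>, hence in \<open>a V\<close>, for
  some \<open>a \<in> A\<close>.\<close>

lemma (in topological_group) omega_narrow_of_separable_quotients:
  assumes "\<And>W. openin T W \<Longrightarrow> \<one> \<in> W \<Longrightarrow>
    \<exists>H. subgroup H G \<and> H \<subseteq> W \<and> separable_space (coset_topology G T H)"
  shows "omega_narrow G T"
  unfolding omega_narrow_def
proof (intro allI impI, elim conjE)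
  fix V assume V: "openin T V" "\<one> \<in> V"
  obtain W where W: "openin T W" "\<one> \<in> W" "\<And>x y. x \<in> W \<Longrightarrow> y \<in> W \<Longrightarrow> x \<otimes> y \<in> V"
    using nbhd_mult[OF V] by blast
  obtain H where sH: "subgroup H G" and H: "H \<subseteq> W" "separable_space (coset_topology G T H)"
    using assms[OF W(1,2)] by blast
  let ?p = "coset_map G H"
  obtain D where D: "countable D" "D \<subseteq> topspace (coset_topology G T H)"
      "(coset_topology G T H) closure_of D = topspace (coset_topology G T H)"
    using H(2) unfolding separable_space_def by (elim exE conjE)
  have "D \<subseteq> ?p ` carrier G" using D(2) by (simp only: topspace_coset)
  with D(1) obtain A where A: "countable A" "A \<subseteq> carrier G" "D = ?p ` A"
    using countable_subset_image[of D ?p "carrier G"] by metis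
  have "x \<in> A <#> V" if x: "x \<in> carrier G" for x
  proof -
    \<comment> \<open>\<open>N\<close> is \<open>x\<close> times the inverse of \<open>W\<close>, an
      open neighbourhood of \<open>x\<close>. Its image is open and so contains the coset of some
      \<open>a \<in> A\<close>, say as the coset of \<open>y \<in> N\<close>; then
      \<open>inv a \<otimes> y\<close> is in \<open>H\<close> and \<open>inv y \<otimes> x\<close>
      in \<open>W\<close>.\<close>
    define N where "N = {y \<in> carrier G. inv y \<otimes> x \<in> W}"
    have N: "openin T N" "x \<in> N"
      unfolding N_def using x W(1,2)
      by (auto intro!: openin_preimage continuous_map_mult continuous_map_inv
          simp: topspace_eq_carrier)
    then have "openin (coset_topology G T H) (?p ` N)" "?p x \<in> ?p ` N"
      using openin_coset_map_image[OF sH] by auto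
    then have "D \<inter> ?p ` N \<noteq> {}"
      using D(3) unfolding dense_intersects_open by blast
    then obtain a y where ay: "a \<in> A" "y \<in> N" "?p a = ?p y"
      unfolding A(3) by auto
    have carr: "a \<in> carrier G" "y \<in> carrier G" using ay(1,2) A(2) by (auto simp: N_def)
    have "inv a \<otimes> y \<in> W" "inv y \<otimes> x \<in> W"
      using coset_map_eq_iff[OF sH carr] ay(2,3) H(1) by (auto simp: N_def)
    then have "(inv a \<otimes> y) \<otimes> (inv y \<otimes> x) \<in> V" by (rule W(3))
    moreover have "x = a \<otimes> ((inv a \<otimes> y) \<otimes> (inv y \<otimes> x))"
      using carr x by (simp add: m_assoc mult_inv_mult_cancel)
    ultimately show ?thesis using ay(1) unfolding set_mult_def by blast
  qed
  moreover have "A <#> V \<subseteq> carrier G"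
    using A(2) V(1) openin_carrier by (auto simp: set_mult_def)
  ultimately show "\<exists>A. countable A \<and> A \<subseteq> carrier G \<and> A <#> V = carrier G"
    using A(1,2) by (intro exI[of _ A]) auto
qed

theorem corollary2p9:
  fixes G :: "('a, 'b) monoid_scheme" and T :: "'a topology"
  assumes "topological_group G T" and "Hausdorff_space T"
  shows "omega_narrow G T \<and> strict_q_space T \<longleftrightarrow>
    (\<forall>W. openin T W \<and> \<one>\<^bsub>G\<^esub> \<in> W \<longrightarrow>
      (\<exists>H. H \<lhd> G \<and> closedin T H \<and> sequentially_compactin T H \<and>
           countable_character_in T H \<and> H \<subseteq> W \<and>
           sequential_perfect_map T (coset_topology G T H) (coset_map G H) \<and>
           separable_space (coset_topology G T H) \<and>
           metrizable_space (coset_topology G T H)))"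
proof -
  interpret topological_group G T by fact
  show ?thesis
  proof (intro iffI conjI allI impI; (elim conjE)?)
    fix W assume "omega_narrow G T" "strict_q_space T" "openin T W" "\<one>\<^bsub>G\<^esub> \<in> W"
    then show "\<exists>H. H \<lhd> G \<and> closedin T H \<and> sequentially_compactin T H \<and>
           countable_character_in T H \<and> H \<subseteq> W \<and>
           sequential_perfect_map T (coset_topology G T H) (coset_map G H) \<and>
           separable_space (coset_topology G T H) \<and>
           metrizable_space (coset_topology G T H)"
      by (rule omega_narrow_strict_q_imp)
  next
    assume quot: "\<forall>W. openin T W \<and> \<one>\<^bsub>G\<^esub> \<in> W \<longrightarrow>
      (\<exists>H. H \<lhd> G \<and> closedin T H \<and> sequentially_compactin T H \<and>
           countable_character_in T H \<and> H \<subseteq> W \<and>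
           sequential_perfect_map T (coset_topology G T H) (coset_map G H) \<and>
           separable_space (coset_topology G T H) \<and>
           metrizable_space (coset_topology G T H))"
    show "omega_narrow G T"
    proof (rule omega_narrow_of_separable_quotients)
      fix W assume "openin T W" "\<one>\<^bsub>G\<^esub> \<in> W"
      with quot show "\<exists>H. subgroup H G \<and> H \<subseteq> W \<and> separable_space (coset_topology G T H)"
        using normal_imp_subgroup by metis
    qed
    \<comment> \<open>A single quotient suffices for the strict q-property, so the whole group
      serves as the neighbourhood.\<close>
    have "openin T (carrier G) \<and> \<one>\<^bsub>G\<^esub> \<in> carrier G" by simp
    with quot obtain H where "sequential_perfect_map T (coset_topology G T H) (coset_map G H)"
      "metrizable_space (coset_topology G T H)" by metis
    then show "strict_q_space T" by (intro strict_q_space_sequential_perfect_preimage)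
  qed
qed

end
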